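(* Let $n\ge 3$ be odd, let $C_n$ be the cycle on $n$ vertices $x_1,\ldots,x_n$, let $K$ be a field and let $I=I(C_n)\subset S=K[x_1,\ldots,x_n]$ be its edge ideal. Then $\mathrm v(I^{k})=2k-1$ for all $k\geq \lfloor\frac{n}{2}\rfloor$.
   Context: $S=\bigoplus_{d\ge 0}S_d$ is graded with $\deg x_i=1$. $C_n$ has edges $\{x_i,x_{i+1}\}$ for $1\le i<n$ and $\{x_n,x_1\}$, so $I(C_n)=\langle x_1x_2,\ldots,x_{n-1}x_n,x_nx_1\rangle$. For a proper graded ideal $I\subset S$, $\mathrm{v}(I):=\min\{d\geq 0\mid \exists f\in S_d,\ \mathfrak{p}\in\operatorname{Ass}(I)\text{ with }(I:f)=\mathfrak{p}\}$, where $\operatorname{Ass}(I)$ is the set of associated primes of $S/I$ and $(I:f)=\{g\in S\mid gf\in I\}$. *)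

theory Defs
  imports "HOL-Library.Poly_Mapping" "HOL-Library.Extended_Nat"
    "HOL-Algebra.QuotRing" "HOL-Algebra.Ideal_Product"
begin

text \<open>A monomial is a finitely supported exponent vector and a polynomial is a finitely
  supported map from monomials to coefficients, so that the type class operations on
  \<open>'a mpoly\<close> are those of the polynomial ring in the variables \<open>x\<^sub>i\<close>, \<open>i :: nat\<close>. The ring
  \<open>K[x\<^sub>1, \<dots>, x\<^sub>n]\<close> is the subring of polynomials in which only \<open>x\<^sub>1, \<dots>, x\<^sub>n\<close> occur.\<close>

type_synonym 'a mpoly = "(nat \<Rightarrow>\<^sub>0 nat) \<Rightarrow>\<^sub>0 'a"

definition var :: "nat \<Rightarrow> 'a::field mpoly" where
  "var i = Poly_Mapping.single (Poly_Mapping.single i 1) 1"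

definition poly_ring :: "nat \<Rightarrow> 'a::field mpoly ring" where
  "poly_ring n =
     \<lparr> carrier = {f. \<forall>m\<in>Poly_Mapping.keys f. Poly_Mapping.keys m \<subseteq> {1..n}},
       mult = (*), one = 1, zero = 0, add = (+) \<rparr>"

definition monom_deg :: "(nat \<Rightarrow>\<^sub>0 nat) \<Rightarrow> nat" where
  "monom_deg m = (\<Sum>i\<in>Poly_Mapping.keys m. Poly_Mapping.lookup m i)"

definition graded_part :: "nat \<Rightarrow> nat \<Rightarrow> 'a::field mpoly set" where
  "graded_part n d =
     {f \<in> carrier (poly_ring n). \<forall>m\<in>Poly_Mapping.keys f. monom_deg m = d}"

definition colon :: "('r, 'm) ring_scheme \<Rightarrow> 'r set \<Rightarrow> 'r \<Rightarrow> 'r set" where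
  "colon R I f = {g \<in> carrier R. g \<otimes>\<^bsub>R\<^esub> f \<in> I}"

text \<open>Associated primes of the \<open>R\<close>-module \<open>R/I\<close>: the prime ideals that are annihilators of an
  element \<open>u\<close> of \<open>R/I\<close>, where \<open>r \<in> R\<close> acts on \<open>R/I\<close> as multiplication by its class \<open>I +> r\<close>.\<close>

definition Ass :: "('r, 'm) ring_scheme \<Rightarrow> 'r set \<Rightarrow> 'r set set" where
  "Ass R I = {P. primeideal P R \<and>
     (\<exists>u\<in>carrier (R Quot I).
        P = {r \<in> carrier R. (I +>\<^bsub>R\<^esub> r) \<otimes>\<^bsub>R Quot I\<^esub> u = \<zero>\<^bsub>R Quot I\<^esub>})}"

text \<open>The value is taken in \<open>enat\<close> so that the infimum of the empty set is \<open>\<infinity>\<close>; a finite value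
  is therefore a minimum that is attained.\<close>

definition v_number :: "nat \<Rightarrow> 'a::field mpoly set \<Rightarrow> enat" where
  "v_number n I =
     Inf (enat ` {d. \<exists>f\<in>graded_part n d. \<exists>P\<in>Ass (poly_ring n) I. colon (poly_ring n) I f = P})"

definition cycle_edges :: "nat \<Rightarrow> nat set set" where
  "cycle_edges n = {{i, i + 1} | i. 1 \<le> i \<and> i < n} \<union> {{n, 1}}"

definition edge_ideal :: "nat \<Rightarrow> nat set set \<Rightarrow> 'a::field mpoly set" where
  "edge_ideal n E = Idl\<^bsub>poly_ring n\<^esub> {var i * var j | i j. {i, j} \<in> E}"

text \<open>Powers in \<open>ideals_set R\<close>, whose multiplication is the product of ideals and whose unit is
  the ideal \<open>R\<close>, are the usual powers of ideals.\<close>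

abbreviation ideal_power :: "nat \<Rightarrow> 'a::field mpoly set \<Rightarrow> nat \<Rightarrow> 'a mpoly set" where
  "ideal_power n I k \<equiv> I [^]\<^bsub>ideals_set (poly_ring n)\<^esub> k"

end

theory Submission
  imports Defs
begin

text \<open>
  Write \<open>n = 2m + 1\<close>. Every vertex cover \<open>V\<close> of \<open>C\<^sub>n\<close> gives a grading: let the \<open>V\<close>-weight of a
  monomial be the sum of its exponents at the vertices in \<open>V\<close>. Each edge monomial has weight at
  least \<open>1\<close>, hence each monomial that occurs in an element of \<open>I\<^sup>k\<close> has weight at least \<open>k\<close>; for
  \<open>V\<close> the set of all vertices the weight is the degree and the bound is \<open>2k\<close>. The polynomials all
  of whose monomials have positive \<open>V\<close>-weight form the prime ideal \<open>P\<^sub>V\<close> generated by the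
  variables in \<open>V\<close>.

  Upper bound. Take \<open>V = {n} \<union> {2, 4, \<dots>, 2m}\<close> and
  \<open>f = x\<^sub>1 x\<^sub>2 \<cdots> x\<^bsub>2m-1\<^esub> (x\<^sub>1 x\<^sub>2)\<^bsup>k-m\<^esup>\<close>, which has degree \<open>2k - 1\<close> and \<open>V\<close>-weight \<open>k - 1\<close>.
  If \<open>g f \<in> I\<^sup>k\<close>, every monomial of \<open>g\<close> must therefore have positive weight, so
  \<open>(I\<^sup>k : f) \<subseteq> P\<^sub>V\<close>. Conversely, with \<open>y\<^sub>0 = x\<^sub>n\<close> and \<open>y\<^sub>i = x\<^sub>i\<close> the cycle contains the path
  \<open>y\<^sub>0, y\<^sub>1, \<dots>, y\<^bsub>2m\<^esub>\<close>, and \<open>V\<close> consists of its vertices of even index. The product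
  \<open>y\<^bsub>2j\<^esub> \<cdot> y\<^sub>1 \<cdots> y\<^bsub>2m-1\<^esub>\<close> is that of the path \<open>y\<^sub>0, \<dots>, y\<^bsub>2m-1\<^esub>\<close> if \<open>j = 0\<close>, and otherwise that
  of the two paths \<open>y\<^sub>1, \<dots>, y\<^bsub>2j\<^esub>\<close> and \<open>y\<^bsub>2j\<^esub>, \<dots>, y\<^bsub>2m-1\<^esub>\<close>, the second of which is
  empty for \<open>j = m\<close>. These have an even number of vertices, \<open>2m\<close> in total, so pairing neighbours
  gives a product of \<open>m\<close> edges (lemma \<open>path_product_in_power\<close>). As \<open>x\<^sub>1 x\<^sub>2\<close> is an edge as well,
  \<open>x\<^sub>v f \<in> I\<^sup>k\<close> for all \<open>v \<in> V\<close>, and hence \<open>(I\<^sup>k : f) = P\<^sub>V\<close>.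

  Lower bound. If \<open>(I\<^sup>k : f)\<close> is prime, it contains \<open>(x\<^sub>1 x\<^sub>2)\<^sup>k\<close>, hence a variable \<open>x\<close>. Then
  \<open>x f\<close> is a nonzero element of \<open>I\<^sup>k\<close>, which is generated in degree \<open>2k\<close>, so
  \<open>deg f + 1 \<ge> 2k\<close> (lemma \<open>degree_bound_of_prime_colon\<close>).
\<close>

section \<open>Colon ideals\<close>

lemma (in cring) colon_is_ideal:
  assumes "ideal I R" "f \<in> carrier R"
  shows "ideal (colon R I f) R"
proof -
  interpret I: ideal I R by fact
  show ?thesis
  proof (rule idealI[OF ring_axioms])
    show "subgroup (colon R I f) (add_monoid R)"
    proof (rule add.subgroupI)
      show "colon R I f \<noteq> {}"
        using assms(2) I.zero_closed by (auto simp: colon_def intro!: exI[of _ \<zero>])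
    qed (use assms(2) in \<open>auto simp: colon_def l_distr l_minus
           intro: I.a_closed I.a_inv_closed\<close>)
  next
    fix a x assume a: "a \<in> colon R I f" and x: "x \<in> carrier R"
    then show "x \<otimes> a \<in> colon R I f"
      using assms(2) by (auto simp: colon_def m_assoc intro: I.I_l_closed)
    with a x show "a \<otimes> x \<in> colon R I f"
      by (simp add: colon_def m_comm)
  qed
qed

text \<open>The annihilator of the class of \<open>f\<close> in \<open>R/I\<close> is \<open>(I : f)\<close>.\<close>

lemma (in cring) prime_colon_in_Ass:
  assumes I: "ideal I R" and f: "f \<in> carrier R" and prime: "primeideal (colon R I f) R"
  shows "colon R I f \<in> Ass R I"
proof -
  interpret I: ideal I R by fact
  have coset: "(I +> a = I) = (a \<in> I)" if "a \<in> carrier R" for a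
    using that I.rcos_const_imp_mem a_rcos_zero[OF I] by blast
  have "(I +> r) \<otimes>\<^bsub>R Quot I\<^esub> (I +> f) = \<zero>\<^bsub>R Quot I\<^esub> \<longleftrightarrow> r \<otimes> f \<in> I" if "r \<in> carrier R" for r
    using that f by (simp add: FactRing_def I.rcoset_mult_add coset)
  then have "colon R I f = {r \<in> carrier R. (I +> r) \<otimes>\<^bsub>R Quot I\<^esub> (I +> f) = \<zero>\<^bsub>R Quot I\<^esub>}"
    unfolding colon_def by blast
  moreover have "I +> f \<in> carrier (R Quot I)"
    using f by (auto simp: FactRing_def A_RCOSETS_def')
  ultimately show ?thesis
    using prime unfolding Ass_def by blast
qed

section \<open>The polynomial ring\<close>

lemma poly_ring_ops [simp]:
  "mult (poly_ring n) = (*)" "one (poly_ring n) = 1"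
  "zero (poly_ring n) = 0" "add (poly_ring n) = (+)"
  by (simp_all add: poly_ring_def)

lemma carrier_poly_ring:
  "f \<in> carrier (poly_ring n) \<longleftrightarrow> (\<forall>m\<in>Poly_Mapping.keys f. Poly_Mapping.keys m \<subseteq> {1..n})"
  by (simp add: poly_ring_def)

lemma carrier_poly_ring_add:
  "f \<in> carrier (poly_ring n) \<Longrightarrow> g \<in> carrier (poly_ring n) \<Longrightarrow> f + g \<in> carrier (poly_ring n)"
  using Poly_Mapping.keys_add[of f g] by (auto simp: carrier_poly_ring)

lemma carrier_poly_ring_uminus:
  fixes f :: "'k::field mpoly"
  assumes "f \<in> carrier (poly_ring n)"
  shows "- f \<in> carrier (poly_ring n)"
  using assms by (simp add: carrier_poly_ring in_keys_iff)

lemma carrier_poly_ring_mult: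
  fixes f :: "'k::field mpoly"
  assumes "f \<in> carrier (poly_ring n)" "g \<in> carrier (poly_ring n)"
  shows "f * g \<in> carrier (poly_ring n)"
  unfolding carrier_poly_ring
proof
  fix c assume "c \<in> Poly_Mapping.keys (f * g)"
  then obtain a b where "c = a + b" "a \<in> Poly_Mapping.keys f" "b \<in> Poly_Mapping.keys g"
    using Poly_Mapping.keys_mult[of f g] by blast
  with assms show "Poly_Mapping.keys c \<subseteq> {1..n}"
    using Poly_Mapping.keys_add[of a b] unfolding carrier_poly_ring by blast
qed

lemma cring_poly_ring: "cring (poly_ring n :: 'k::field mpoly ring)"
proof (rule cringI)
  show "abelian_group (poly_ring n :: 'k mpoly ring)"
  proof (rule abelian_groupI)
    fix f :: "'k mpoly" assume "f \<in> carrier (poly_ring n)"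
    then show "\<exists>g\<in>carrier (poly_ring n). g \<oplus>\<^bsub>poly_ring n\<^esub> f = \<zero>\<^bsub>poly_ring n\<^esub>"
      by (intro bexI[of _ "- f"]) (simp_all add: carrier_poly_ring_uminus)
  qed (auto simp: carrier_poly_ring_add add_ac, simp add: carrier_poly_ring)
  show "comm_monoid (poly_ring n :: 'k mpoly ring)"
    by (rule comm_monoidI) (auto simp: carrier_poly_ring_mult mult_ac, simp add: carrier_poly_ring)
qed (simp add: distrib_right)

lemmas ring_poly_ring = cring.axioms(1)[OF cring_poly_ring]

lemma monomial_in_poly_ring:
  "Poly_Mapping.keys m \<subseteq> {1..n} \<Longrightarrow> Poly_Mapping.single m c \<in> carrier (poly_ring n)"
  by (simp add: carrier_poly_ring)

lemma var_in_poly_ring: "i \<in> {1..n} \<Longrightarrow> var i \<in> carrier (poly_ring n)"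
  unfolding var_def by (rule monomial_in_poly_ring) simp

text \<open>The closure properties of ideals in terms of the type class operations, in which the
  computations with polynomials are carried out.\<close>

lemma
  fixes J :: "'k::field mpoly set"
  assumes "ideal J (poly_ring n)"
  shows poly_ideal_zero: "0 \<in> J"
    and poly_ideal_add: "a \<in> J \<Longrightarrow> b \<in> J \<Longrightarrow> a + b \<in> J"
    and poly_ideal_mult_left: "a \<in> J \<Longrightarrow> x \<in> carrier (poly_ring n) \<Longrightarrow> x * a \<in> J"
    and poly_ideal_mult_right: "a \<in> J \<Longrightarrow> x \<in> carrier (poly_ring n) \<Longrightarrow> a * x \<in> J"
    and poly_ideal_carrier: "a \<in> J \<Longrightarrow> a \<in> carrier (poly_ring n)"
proof -
  interpret ideal J "poly_ring n" by fact
  show "0 \<in> J" "a \<in> J \<Longrightarrow> b \<in> J \<Longrightarrow> a + b \<in> J"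
    "a \<in> J \<Longrightarrow> x \<in> carrier (poly_ring n) \<Longrightarrow> x * a \<in> J"
    "a \<in> J \<Longrightarrow> x \<in> carrier (poly_ring n) \<Longrightarrow> a * x \<in> J"
    "a \<in> J \<Longrightarrow> a \<in> carrier (poly_ring n)"
    using additive_subgroup.zero_closed[OF is_additive_subgroup]
      additive_subgroup.a_closed[OF is_additive_subgroup, of a b]
      I_l_closed[of a x] I_r_closed[of a x] Icarr[of a] by simp_all
qed

lemma poly_ideal_sum:
  fixes J :: "'k::field mpoly set"
  assumes "ideal J (poly_ring n)" "\<And>a. a \<in> A \<Longrightarrow> g a \<in> J"
  shows "sum g A \<in> J"
  using assms(2)
  by (induction A rule: infinite_finite_induct)
     (auto intro: poly_ideal_zero[OF assms(1)] poly_ideal_add[OF assms(1)])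

lemma sum_of_monomials:
  fixes f :: "'k::field mpoly"
  shows "(\<Sum>m\<in>Poly_Mapping.keys f. Poly_Mapping.single m (Poly_Mapping.lookup f m)) = f"
  by (rule poly_mapping_eqI)
     (auto simp: lookup_sum lookup_single when_def sum.delta in_keys_iff)

lemma keys_mult_monomial:
  fixes f :: "'k::field mpoly"
  assumes "a \<in> Poly_Mapping.keys f"
  shows "a + b \<in> Poly_Mapping.keys (f * Poly_Mapping.single b 1)"
proof -
  have "f * Poly_Mapping.single b 1 =
      (\<Sum>m\<in>Poly_Mapping.keys f. Poly_Mapping.single (m + b) (Poly_Mapping.lookup f m))"
    by (subst (1) sum_of_monomials[of f, symmetric]) (simp add: sum_distrib_right mult_single)
  then have "Poly_Mapping.lookup (f * Poly_Mapping.single b 1) (a + b) = Poly_Mapping.lookup f a"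
    using assms by (simp add: lookup_sum lookup_single when_def sum.delta in_keys_iff)
  with assms show ?thesis
    by (simp add: in_keys_iff)
qed

section \<open>Weights of monomials\<close>

definition weight :: "nat set \<Rightarrow> (nat \<Rightarrow>\<^sub>0 nat) \<Rightarrow> nat" where
  "weight V m = (\<Sum>i\<in>V. Poly_Mapping.lookup m i)"

definition weight_ideal :: "nat \<Rightarrow> nat set \<Rightarrow> nat \<Rightarrow> 'k::field mpoly set" where
  "weight_ideal n V c = {f \<in> carrier (poly_ring n). \<forall>m\<in>Poly_Mapping.keys f. c \<le> weight V m}"

lemma weight_add: "weight V (a + b) = weight V a + weight V b"
  by (simp add: weight_def lookup_add sum.distrib)

lemma weight_sum: "weight V (\<Sum>i\<in>A. g i) = (\<Sum>i\<in>A. weight V (g i))"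
  by (induction A rule: infinite_finite_induct) (simp_all add: weight_add, simp_all add: weight_def)

lemma weight_single:
  "finite V \<Longrightarrow> weight V (Poly_Mapping.single i a) = (if i \<in> V then a else 0)"
  by (simp add: weight_def lookup_single when_def sum.delta)

lemma monom_deg_eq_weight:
  "Poly_Mapping.keys m \<subseteq> {1..n} \<Longrightarrow> monom_deg m = weight {1..n} m"
  unfolding monom_deg_def weight_def by (rule sum.mono_neutral_left) (auto simp: in_keys_iff)

lemma weight_ideal_mult:
  fixes f :: "'k::field mpoly"
  assumes "f \<in> weight_ideal n V a" "g \<in> weight_ideal n V b"
  shows "f * g \<in> weight_ideal n V (a + b)"
proof -
  have "a + b \<le> weight V c" if c: "c \<in> Poly_Mapping.keys (f * g)" for c
  proof -
    obtain p q where "c = p + q" "p \<in> Poly_Mapping.keys f" "q \<in> Poly_Mapping.keys g"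
      using c Poly_Mapping.keys_mult[of f g] by blast
    then show ?thesis
      using assms by (auto simp: weight_ideal_def weight_add intro: add_mono)
  qed
  then show ?thesis
    using assms by (simp add: weight_ideal_def carrier_poly_ring_mult)
qed

lemma weight_ideal_add:
  fixes f :: "'k::field mpoly"
  assumes "f \<in> weight_ideal n V c" "g \<in> weight_ideal n V c"
  shows "f + g \<in> weight_ideal n V c"
  using assms Poly_Mapping.keys_add[of f g] by (auto simp: weight_ideal_def carrier_poly_ring_add)

lemma weight_ideal_is_ideal: "ideal (weight_ideal n V c :: 'k::field mpoly set) (poly_ring n)"
proof (rule idealI[OF ring_poly_ring])
  interpret cring "poly_ring n :: 'k mpoly ring" by (rule cring_poly_ring)
  show "subgroup (weight_ideal n V c :: 'k mpoly set) (add_monoid (poly_ring n))"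
  proof (rule add.subgroupI)
    show "(weight_ideal n V c :: 'k mpoly set) \<noteq> {}"
      by (auto simp: weight_ideal_def carrier_poly_ring intro!: exI[of _ 0])
    fix f :: "'k mpoly" assume f: "f \<in> weight_ideal n V c"
    then have "f \<in> carrier (poly_ring n)"
      by (simp add: weight_ideal_def)
    then have "\<ominus>\<^bsub>poly_ring n\<^esub> f = - f"
      using minus_equality[of "- f" f] by (simp add: carrier_poly_ring_uminus)
    with f show "\<ominus>\<^bsub>poly_ring n\<^esub> f \<in> weight_ideal n V c"
      by (simp add: weight_ideal_def carrier_poly_ring_uminus in_keys_iff)
  qed (auto simp: weight_ideal_add, simp add: weight_ideal_def)
next
  fix f x :: "'k mpoly" assume "f \<in> weight_ideal n V c" "x \<in> carrier (poly_ring n)"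
  then have "f * x \<in> weight_ideal n V (c + 0)"
    by (intro weight_ideal_mult) (auto simp: weight_ideal_def)
  then show "f \<otimes>\<^bsub>poly_ring n\<^esub> x \<in> weight_ideal n V c" "x \<otimes>\<^bsub>poly_ring n\<^esub> f \<in> weight_ideal n V c"
    by (simp_all add: mult.commute)
qed

text \<open>Modulo \<open>weight_ideal n V 1\<close> only the part of weight \<open>0\<close> of a polynomial matters. The product
  of two such parts has weight \<open>0\<close> again, so it lies in the ideal only if it vanishes, and then one
  of the factors vanishes.\<close>

lemma weight_ideal_prime:
  assumes "finite V"
  shows "primeideal (weight_ideal n V 1 :: 'k::field mpoly set) (poly_ring n)"
proof (rule primeidealI[OF weight_ideal_is_ideal cring_poly_ring])
  note J = weight_ideal_is_ideal[of n V 1, where 'k = 'k]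
  have "(1 :: 'k mpoly) \<in> carrier (poly_ring n)" "(1 :: 'k mpoly) \<notin> weight_ideal n V 1"
    by (auto simp: weight_ideal_def carrier_poly_ring weight_def)
  then show "carrier (poly_ring n) \<noteq> (weight_ideal n V 1 :: 'k mpoly set)"
    by blast
  have split: "\<exists>p q. f = p + q \<and> p \<in> weight_ideal n V 1 \<and> q \<in> carrier (poly_ring n) \<and>
      (\<forall>m\<in>Poly_Mapping.keys q. weight V m = 0)"
    if f: "f \<in> carrier (poly_ring n)" for f :: "'k mpoly"
  proof -
    let ?t = "\<lambda>m. Poly_Mapping.single m (Poly_Mapping.lookup f m)"
    let ?A = "{m \<in> Poly_Mapping.keys f. weight V m \<noteq> 0}"
    let ?B = "{m \<in> Poly_Mapping.keys f. weight V m = 0}"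
    have "f = sum ?t (?A \<union> ?B)"
      by (subst sum_of_monomials[of f, symmetric]) (rule sum.cong, auto)
    also have "\<dots> = sum ?t ?A + sum ?t ?B"
      by (rule sum.union_disjoint) auto
    finally have "f = sum ?t ?A + sum ?t ?B" .
    moreover have "sum ?t ?A \<in> weight_ideal n V 1"
      using f by (intro poly_ideal_sum[OF J])
        (auto simp: weight_ideal_def carrier_poly_ring in_keys_iff split: if_splits)
    moreover have "Poly_Mapping.keys (sum ?t ?B) \<subseteq> ?B"
      by (auto simp: in_keys_iff lookup_sum lookup_single when_def sum.delta split: if_splits)
    ultimately show ?thesis
      using f unfolding carrier_poly_ring by blast
  qed
  fix f g :: "'k mpoly"
  assume f: "f \<in> carrier (poly_ring n)" and g: "g \<in> carrier (poly_ring n)"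
    and fg: "f \<otimes>\<^bsub>poly_ring n\<^esub> g \<in> weight_ideal n V 1"
  obtain p q where pq: "f = p + q" "p \<in> weight_ideal n V 1" "q \<in> carrier (poly_ring n)"
      "\<forall>m\<in>Poly_Mapping.keys q. weight V m = 0"
    using split[OF f] by blast
  obtain r s where rs: "g = r + s" "r \<in> weight_ideal n V 1" "s \<in> carrier (poly_ring n)"
      "\<forall>m\<in>Poly_Mapping.keys s. weight V m = 0"
    using split[OF g] by blast
  have "q * s = f * g + p * (- g) + (- q) * r"
    by (simp add: pq(1) rs(1) algebra_simps)
  also have "\<dots> \<in> weight_ideal n V 1"
    using fg poly_ideal_mult_right[OF J pq(2) carrier_poly_ring_uminus[OF g]]
      poly_ideal_mult_left[OF J rs(2) carrier_poly_ring_uminus[OF pq(3)]]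
    by (intro poly_ideal_add[OF J]) simp_all
  finally have *: "q * s \<in> weight_ideal n V 1" .
  have "c \<notin> Poly_Mapping.keys (q * s)" for c
  proof
    assume c: "c \<in> Poly_Mapping.keys (q * s)"
    then obtain a b where "c = a + b" "a \<in> Poly_Mapping.keys q" "b \<in> Poly_Mapping.keys s"
      using Poly_Mapping.keys_mult[of q s] by blast
    with pq(4) rs(4) have "weight V c = 0"
      by (simp add: weight_add)
    with * c show False
      by (auto simp: weight_ideal_def)
  qed
  then have "q * s = 0"
    by (auto simp: poly_mapping_eq_iff in_keys_iff fun_eq_iff)
  then have "q = 0 \<or> s = 0"
    by simp
  with pq(1,2) rs(1,2) show "f \<in> weight_ideal n V 1 \<or> g \<in> weight_ideal n V 1"
    by auto
qed

text \<open>The prime ideal \<open>weight_ideal n V 1\<close> is generated by the variables in \<open>V\<close>: a monomial of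
  positive weight is divisible by one of them.\<close>

lemma weight_ideal_subset_if_vars:
  fixes J :: "'k::field mpoly set"
  assumes J: "ideal J (poly_ring n)" and vars: "\<And>v. v \<in> V \<Longrightarrow> var v \<in> J"
  shows "weight_ideal n V 1 \<subseteq> J"
proof
  fix g :: "'k mpoly" assume g: "g \<in> weight_ideal n V 1"
  have "Poly_Mapping.single m (Poly_Mapping.lookup g m) \<in> J" if m: "m \<in> Poly_Mapping.keys g" for m
  proof -
    have "weight V m \<noteq> 0" and km: "Poly_Mapping.keys m \<subseteq> {1..n}"
      using g m by (auto simp: weight_ideal_def carrier_poly_ring)
    then obtain v where v: "v \<in> V" "Poly_Mapping.lookup m v \<noteq> 0"
      unfolding weight_def by (metis sum.neutral)
    have "m = (m - Poly_Mapping.single v 1) + Poly_Mapping.single v 1"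
      using v by (intro poly_mapping_eqI) (auto simp: lookup_add lookup_minus lookup_single when_def)
    then have "Poly_Mapping.single m (Poly_Mapping.lookup g m) =
        Poly_Mapping.single (m - Poly_Mapping.single v 1) (Poly_Mapping.lookup g m) * var v"
      unfolding var_def by (metis mult_single mult.right_neutral)
    moreover have "Poly_Mapping.keys (m - Poly_Mapping.single v 1) \<subseteq> {1..n}"
      using km by (auto simp: in_keys_iff lookup_minus)
    ultimately show ?thesis
      using vars[OF v(1)] poly_ideal_mult_left[OF J] monomial_in_poly_ring by metis
  qed
  then show "g \<in> J"
    using poly_ideal_sum[OF J] sum_of_monomials[of g] by metis
qed

section \<open>Powers of ideals\<close>

lemma ideal_power_0: "ideal_power n I 0 = carrier (poly_ring n)"
  by (simp add: nat_pow_def ideals_set_def)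

lemma one_in_ideal_power_0: "1 \<in> ideal_power n I 0"
  unfolding ideal_power_0 by (simp add: carrier_poly_ring)

lemma ideal_power_Suc:
  "ideal_power n I (Suc k) = ideal_prod (poly_ring n) (ideal_power n I k) I"
  by (simp add: nat_pow_def ideals_set_def)

lemma ideal_power_is_ideal:
  fixes I :: "'k::field mpoly set"
  assumes "ideal I (poly_ring n)"
  shows "ideal (ideal_power n I k) (poly_ring n)"
proof (induction k)
  case 0
  then show ?case
    unfolding ideal_power_0 by (rule ring.oneideal[OF ring_poly_ring])
next
  case (Suc k)
  then show ?case
    unfolding ideal_power_Suc by (rule ring.ideal_prod_is_ideal[OF ring_poly_ring _ assms])
qed

lemma ideal_power_mult:
  "f \<in> ideal_power n I k \<Longrightarrow> g \<in> I \<Longrightarrow> f * g \<in> ideal_power n I (Suc k)"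
  unfolding ideal_power_Suc using ideal_prod.prod[of f _ g I "poly_ring n"] by simp

lemma ideal_power_mult_power:
  fixes I :: "'k::field mpoly set"
  assumes "f \<in> ideal_power n I k" "g \<in> I"
  shows "f * g ^ r \<in> ideal_power n I (k + r)"
proof (induction r)
  case (Suc r)
  then show ?case
    using ideal_power_mult[OF Suc assms(2)] by (simp add: mult_ac)
qed (use assms in simp)

lemma ideal_power_weight:
  fixes I :: "'k::field mpoly set"
  assumes "I \<subseteq> weight_ideal n V c"
  shows "ideal_power n I k \<subseteq> weight_ideal n V (c * k)"
proof (induction k)
  case 0
  then show ?case
    unfolding ideal_power_0 by (auto simp: weight_ideal_def)
next
  case (Suc k)
  show ?case
  proof
    fix f assume "f \<in> ideal_power n I (Suc k)"
    then have "f \<in> ideal_prod (poly_ring n) (ideal_power n I k) I"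
      by (simp only: ideal_power_Suc)
    then show "f \<in> weight_ideal n V (c * Suc k)"
    proof induction
      case (prod i j)
      then show ?case
        using weight_ideal_mult[of i n V "c * k" j c] Suc assms by (auto simp: add.commute)
    qed (simp add: weight_ideal_add)
  qed
qed

text \<open>The induction shortens the path \<open>y\<^sub>0, \<dots>, y\<^bsub>2m+2\<^esub>\<close> by two vertices. If \<open>j \<le> m\<close>, split off
  the edge \<open>y\<^bsub>2m\<^esub> y\<^bsub>2m+1\<^esub>\<close>. If \<open>j = m + 1\<close>, split off \<open>y\<^bsub>2m+1\<^esub> y\<^bsub>2m+2\<^esub>\<close>; what remains is
  \<open>y\<^bsub>2m\<^esub> \<cdot> y\<^sub>1 \<cdots> y\<^bsub>2m-1\<^esub>\<close>, the product for the shorter path and its own last vertex.\<close>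

lemma path_product_in_power:
  fixes I :: "'k::field mpoly set" and y :: "nat \<Rightarrow> 'k mpoly"
  assumes I: "ideal I (poly_ring n)" and "1 \<le> m"
    and "\<And>i. i < 2 * m \<Longrightarrow> y i * y (i + 1) \<in> I" and "j \<le> m"
  shows "y (2 * j) * (\<Prod>i\<in>{1..<2 * m}. y i) \<in> ideal_power n I m"
  using assms(2-4)
proof (induction m arbitrary: j rule: nat_induct_at_least)
  case base
  have one: "1 * g \<in> ideal_power n I (Suc 0)" if "g \<in> I" for g
    using that by (intro ideal_power_mult one_in_ideal_power_0)
  have "j = 0 \<or> j = 1" using base by auto
  then show ?case
    using one[OF base(1)[of 0]] one[OF base(1)[of 1]]
    by (auto simp: numeral_2_eq_2 mult.commute)
next
  case (Suc m)
  have "{1..<2 * Suc m} = insert (2 * m + 1) (insert (2 * m) {1..<2 * m})"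
    using Suc.hyps by auto
  then have prod: "(\<Prod>i\<in>{1..<2 * Suc m}. y i) = (y (2*m) * y (2*m+1)) * (\<Prod>i\<in>{1..<2 * m}. y i)"
    by (simp add: mult_ac)
  have IH: "y (2 * i) * (\<Prod>i\<in>{1..<2 * m}. y i) \<in> ideal_power n I m" if "i \<le> m" for i
    using Suc.IH[of i] Suc.prems(1) that by simp
  show ?case
  proof (cases "j \<le> m")
    case True
    show ?thesis
      using ideal_power_mult[OF IH[OF True] Suc.prems(1)[of "2*m"]]
      unfolding prod by (simp add: mult_ac)
  next
    case False
    then have "2 * j = 2 * m + 2" using Suc.prems by simp
    then show ?thesis
      using ideal_power_mult[OF IH[OF order_refl] Suc.prems(1)[of "2*m+1"]]
      unfolding prod by (simp add: mult_ac)
  qed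
qed

section \<open>The lower bound\<close>

lemma primeideal_power_mem:
  fixes P :: "'k::field mpoly set"
  assumes P: "primeideal P (poly_ring n)" and a: "a \<in> carrier (poly_ring n)" and "a ^ k \<in> P"
  shows "a \<in> P"
proof -
  interpret P: primeideal P "poly_ring n" by fact
  have pow: "a ^ k \<in> carrier (poly_ring n)" for k
    by (induction k) (simp_all add: a carrier_poly_ring_mult, simp add: carrier_poly_ring)
  show ?thesis
    using \<open>a ^ k \<in> P\<close>
  proof (induction k)
    case 0
    then show ?case
      using P.one_imp_carrier P.I_notcarr by simp
  next
    case (Suc k)
    then show ?case
      using P.I_prime[of a "a ^ k"] a pow by auto
  qed
qed

lemma degree_bound_of_prime_colon:
  fixes J :: "'k::field mpoly set"
  assumes J: "ideal J (poly_ring n)" and Jdeg: "J \<subseteq> weight_ideal n {1..n} c"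
    and uv: "u \<in> {1..n}" "v \<in> {1..n}" "(var u * var v) ^ k \<in> J"
    and f: "f \<in> graded_part n d" and prime: "primeideal (colon (poly_ring n) J f) (poly_ring n)"
  shows "c \<le> d + 1"
proof -
  let ?P = "colon (poly_ring n) J f"
  have fc: "f \<in> carrier (poly_ring n)"
    using f by (simp add: graded_part_def)
  have vars: "(var u :: 'k mpoly) \<in> carrier (poly_ring n)"
    "(var v :: 'k mpoly) \<in> carrier (poly_ring n)"
    using uv by (simp_all add: var_in_poly_ring)
  have "(var u * var v) ^ k \<in> ?P"
    using poly_ideal_mult_right[OF J uv(3) fc] poly_ideal_carrier[OF J uv(3)]
    by (simp add: colon_def)
  then have "var u * var v \<in> ?P"
    by (rule primeideal_power_mem[OF prime carrier_poly_ring_mult[OF vars]])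
  then obtain w where w: "w \<in> {1..n}" "var w \<in> ?P"
    using primeideal.I_prime[OF prime vars] uv(1,2) unfolding poly_ring_ops by blast
  have "f \<noteq> 0"
    using primeideal.I_notcarr[OF prime] poly_ideal_zero[OF J] by (auto simp: colon_def)
  moreover have "(var w :: 'k mpoly) \<noteq> 0"
    by (metis var_def lookup_single_eq lookup_zero zero_neq_one)
  ultimately have "var w * f \<noteq> 0"
    by simp
  then obtain p where p: "p \<in> Poly_Mapping.keys (var w * f)"
    by (metis ex_in_conv keys_eq_empty)
  then obtain a where a: "p = Poly_Mapping.single w 1 + a" "a \<in> Poly_Mapping.keys f"
    using Poly_Mapping.keys_mult[of "var w" f] by (auto simp: var_def)
  then have "weight {1..n} a = d"
    using f monom_deg_eq_weight[of a n] by (auto simp: graded_part_def carrier_poly_ring)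
  then have "weight {1..n} p = d + 1"
    using w(1) by (simp add: a(1) weight_add weight_single)
  moreover have "var w * f \<in> weight_ideal n {1..n} c"
    using w(2) Jdeg by (auto simp: colon_def)
  ultimately show ?thesis
    using p by (auto simp: weight_ideal_def)
qed

section \<open>Edge ideals\<close>

lemma edge_ideal_is_ideal:
  assumes "\<Union>E \<subseteq> {1..n}"
  shows "ideal (edge_ideal n E :: 'k::field mpoly set) (poly_ring n)"
  unfolding edge_ideal_def using assms
  by (intro ring.genideal_ideal[OF ring_poly_ring])
     (blast intro: carrier_poly_ring_mult var_in_poly_ring)

lemma edge_in_edge_ideal:
  assumes "\<Union>E \<subseteq> {1..n}" "{i, j} \<in> E"
  shows "(var i * var j :: 'k::field mpoly) \<in> edge_ideal n E"
proof -
  have "{var i * var j :: 'k mpoly | i j. {i, j} \<in> E} \<subseteq> edge_ideal n E"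
    unfolding edge_ideal_def using assms(1)
    by (intro ring.genideal_self[OF ring_poly_ring])
       (blast intro: carrier_poly_ring_mult var_in_poly_ring)
  with assms(2) show ?thesis by blast
qed

lemma edge_ideal_weight:
  assumes "finite V" "\<Union>E \<subseteq> {1..n}"
    and "\<And>i j. {i, j} \<in> E \<Longrightarrow> c \<le> of_bool (i \<in> V) + of_bool (j \<in> V)"
  shows "(edge_ideal n E :: 'k::field mpoly set) \<subseteq> weight_ideal n V c"
  unfolding edge_ideal_def
proof (rule ring.genideal_minimal[OF ring_poly_ring weight_ideal_is_ideal], safe)
  fix i j assume ij: "{i, j} \<in> E"
  have "i \<in> {1..n}" "j \<in> {1..n}" using assms(2) ij by blast+
  then have "(var i * var j :: 'k mpoly) \<in> carrier (poly_ring n)"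
    by (simp add: carrier_poly_ring_mult var_in_poly_ring)
  moreover have "c \<le> weight V (Poly_Mapping.single i 1 + Poly_Mapping.single j 1)"
    using assms(3)[OF ij] assms(1) by (simp only: weight_add weight_single of_bool_def)
  ultimately show "(var i * var j :: 'k mpoly) \<in> weight_ideal n V c"
    by (simp add: weight_ideal_def var_def mult_single)
qed

lemma cycle_edges_vertices: "n \<ge> 3 \<Longrightarrow> \<Union>(cycle_edges n) \<subseteq> {1..n}"
  by (auto simp: cycle_edges_def)

section \<open>The upper bound\<close>

lemma single_eq_var_power:
  "Poly_Mapping.single (Poly_Mapping.single i a) 1 = (var i :: 'k::field mpoly) ^ a"
proof (induction a)
  case (Suc a)
  have "Poly_Mapping.single i (Suc a) = Poly_Mapping.single i 1 + Poly_Mapping.single i a"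
    by (simp add: single_add[symmetric])
  then have "Poly_Mapping.single (Poly_Mapping.single i (Suc a)) 1 =
      var i * Poly_Mapping.single (Poly_Mapping.single i a) (1 :: 'k)"
    unfolding var_def mult_single by simp
  then show ?case
    using Suc by simp
qed simp

lemma single_sum_eq_prod_var:
  "Poly_Mapping.single (\<Sum>i\<in>A. Poly_Mapping.single i 1) 1 = (\<Prod>i\<in>A. var i :: 'k::field mpoly)"
proof (induction A rule: infinite_finite_induct)
  case (insert a A)
  have "Poly_Mapping.single (Poly_Mapping.single a 1 + (\<Sum>i\<in>A. Poly_Mapping.single i 1)) (1 :: 'k) =
      var a * (\<Prod>i\<in>A. var i)"
    unfolding insert.IH[symmetric] unfolding var_def mult_single by simp
  with insert.hyps show ?case
    by simp
qed simp_all

text \<open>The witness is \<open>f = x\<^sub>1 \<cdots> x\<^bsub>2m-1\<^esub> (x\<^sub>1 x\<^sub>2)\<^bsup>k-m\<^esup>\<close>. Its \<open>V\<close>-weight is \<open>k - 1\<close> because \<open>V\<close> contains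
  \<open>m - 1\<close> of the vertices \<open>1, \<dots>, 2m - 1\<close>, and \<open>2\<close> but not \<open>1\<close>.\<close>

lemma odd_cycle_power_colon:
  assumes m: "1 \<le> m" and n: "n = 2 * m + 1" and k: "m \<le> k"
  defines "I \<equiv> edge_ideal n (cycle_edges n) :: 'k::field mpoly set"
    and "V \<equiv> insert n ((*) 2 ` {1..m})"
  shows "\<exists>f\<in>graded_part n (2 * k - 1).
    colon (poly_ring n) (ideal_power n I k) f = weight_ideal n V 1"
proof -
  define \<mu> where "\<mu> = (\<Sum>i\<in>{1..<2*m}. Poly_Mapping.single i 1) +
    (Poly_Mapping.single 1 (k - m) + Poly_Mapping.single 2 (k - m))"
  let ?f = "Poly_Mapping.single \<mu> (1 :: 'k)"
  have vert: "\<Union>(cycle_edges n) \<subseteq> {1..n}"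
    using m n by (intro cycle_edges_vertices) simp
  have I: "ideal I (poly_ring n)"
    unfolding I_def by (rule edge_ideal_is_ideal[OF vert])
  note Ik = ideal_power_is_ideal[OF I, of k]
  have finV: "finite V" by (simp add: V_def)

  have "i \<in> V \<or> j \<in> V" if e: "{i, j} \<in> cycle_edges n" for i j
  proof -
    have even_V: "a \<in> V" if "even a" "1 \<le> a" "a \<le> n" for a
    proof -
      obtain b where "a = 2 * b" using \<open>even a\<close> by blast
      then show ?thesis using that n by (auto simp: V_def)
    qed
    have nV: "n \<in> V" by (simp add: V_def)
    show ?thesis
      using e
    proof (simp add: cycle_edges_def, elim disjE exE conjE)
      assume "{i, j} = {n, Suc 0}" then show ?thesis using nV by (auto simp: doubleton_eq_iff)
    next
      fix a assume "{i, j} = {a, Suc a}" "Suc 0 \<le> a" "a < n"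
      moreover have "a \<in> V \<or> Suc a \<in> V"
        using even_V[of a] even_V[of "Suc a"] calculation by (cases "even a") auto
      ultimately show ?thesis by (auto simp: doubleton_eq_iff)
    qed
  qed
  then have "I \<subseteq> weight_ideal n V 1"
    unfolding I_def by (intro edge_ideal_weight[OF finV vert]) (fastforce simp: of_bool_def)
  from ideal_power_weight[OF this, of k] have Ikw: "ideal_power n I k \<subseteq> weight_ideal n V k"
    by simp

  have keys_sub: "Poly_Mapping.keys \<mu> \<subseteq> {1..n}"
  proof
    fix i assume "i \<in> Poly_Mapping.keys \<mu>"
    then have "i \<in> {1..<2*m} \<or> i = 1 \<or> i = 2"
      unfolding \<mu>_def by (auto simp: in_keys_iff lookup_add lookup_sum lookup_single when_def
        sum.delta split: if_splits)
    with m n show "i \<in> {1..n}" by auto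
  qed
  have fc: "?f \<in> carrier (poly_ring n)"
    by (rule monomial_in_poly_ring[OF keys_sub])
  have "weight {1..n} \<mu> = 2 * k - 1"
  proof -
    have "(\<Sum>i\<in>{1..<2*m}. if i \<in> {1..n} then 1 else 0 :: nat) = (\<Sum>i\<in>{1..<2*m}. 1)"
      using n by (intro sum.cong) auto
    then show ?thesis
      unfolding \<mu>_def weight_add weight_sum using m n k by (simp add: weight_single)
  qed
  then have grade: "?f \<in> graded_part n (2 * k - 1)"
    using fc monom_deg_eq_weight[OF keys_sub] by (simp add: graded_part_def)
  have weight_V: "weight V \<mu> = k - 1"
  proof -
    have "{1..<2*m} \<inter> V = (*) 2 ` {1..<m}"
      using m n unfolding V_def by auto
    then have "(\<Sum>i\<in>{1..<2*m}. if i \<in> V then 1 else 0) = card ((*) (2::nat) ` {1..<m})"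
      by (simp add: sum.If_cases)
    also have "\<dots> = m - 1" by (simp add: card_image inj_on_def)
    finally have "(\<Sum>i\<in>{1..<2*m}. if i \<in> V then 1 else 0) = m - 1" .
    moreover have "1 \<notin> V" "2 \<in> V" using m n by (auto simp: V_def)
    ultimately show ?thesis
      unfolding \<mu>_def weight_add weight_sum using finV m k
      by (simp add: weight_single del: One_nat_def)
  qed

  have "colon (poly_ring n) (ideal_power n I k) ?f \<subseteq> weight_ideal n V 1"
  proof
    fix g assume g: "g \<in> colon (poly_ring n) (ideal_power n I k) ?f"
    have "1 \<le> weight V a" if a: "a \<in> Poly_Mapping.keys g" for a
    proof -
      have "g * ?f \<in> weight_ideal n V k" using g Ikw by (auto simp: colon_def)
      with keys_mult_monomial[OF a, of \<mu>] have "k \<le> weight V (a + \<mu>)"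
        by (simp add: weight_ideal_def)
      then show ?thesis using weight_V m k by (simp add: weight_add)
    qed
    with g show "g \<in> weight_ideal n V 1" by (simp add: weight_ideal_def colon_def)
  qed
  moreover have "weight_ideal n V 1 \<subseteq> colon (poly_ring n) (ideal_power n I k) ?f"
  proof (rule weight_ideal_subset_if_vars[OF cring.colon_is_ideal[OF cring_poly_ring Ik fc]])
    fix v assume v: "v \<in> V"
    \<comment> \<open>The path that runs through all vertices of the cycle, starting at \<open>n\<close>.\<close>
    define y :: "nat \<Rightarrow> 'k mpoly" where "y i = var (if i = 0 then n else i)" for i
    obtain j where j: "j \<le> m" "var v = y (2 * j)"
    proof -
      consider "v = n" | i where "v = 2 * i" "1 \<le> i" "i \<le> m" using v by (auto simp: V_def)
      then show ?thesis
        by cases (use that[of 0] that in \<open>auto simp: y_def\<close>)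
    qed
    have edges: "y i * y (i + 1) \<in> I" if i: "i < 2 * m" for i
    proof -
      have "{if i = 0 then n else i, i + 1} \<in> cycle_edges n"
        using i n by (auto simp: cycle_edges_def)
      from edge_in_edge_ideal[OF vert this] show ?thesis by (simp add: y_def I_def)
    qed
    have "{1, 1 + 1} \<in> cycle_edges n"
      using m n unfolding cycle_edges_def by force
    from edge_in_edge_ideal[OF vert this] have e12: "var 1 * var 2 \<in> I"
      by (simp add: I_def numeral_2_eq_2)
    have "?f = (\<Prod>i\<in>{1..<2*m}. var i) * (var 1 * var 2) ^ (k - m)"
      unfolding \<mu>_def power_mult_distrib single_eq_var_power[symmetric]
        single_sum_eq_prod_var[symmetric] by (simp add: mult_single)
    also have "(\<Prod>i\<in>{1..<2*m}. var i :: 'k mpoly) = (\<Prod>i\<in>{1..<2*m}. y i)"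
      by (rule prod.cong) (auto simp: y_def)
    finally have "var v * ?f = y (2 * j) * (\<Prod>i\<in>{1..<2*m}. y i) * (var 1 * var 2) ^ (k - m)"
      by (simp add: j mult.assoc)
    also have "\<dots> \<in> ideal_power n I k"
      using ideal_power_mult_power[OF path_product_in_power[of I n m y j, OF I m edges j(1)] e12,
          of "k - m"] k by simp
    finally have "var v * ?f \<in> ideal_power n I k" .
    moreover have "v \<in> {1..n}" using v n by (auto simp: V_def)
    ultimately show "var v \<in> colon (poly_ring n) (ideal_power n I k) ?f"
      by (simp add: colon_def var_in_poly_ring)
  qed
  ultimately show ?thesis
    using grade by (intro bexI[of _ ?f]) auto
qed

section \<open>The v-number of the powers\<close>

theorem proposition5p11:
  fixes n :: nat and I :: "'k::field mpoly set"
  assumes "n \<ge> 3" and "odd n"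
    and "I = edge_ideal n (cycle_edges n)"
  shows "\<forall>k \<ge> n div 2. v_number n (ideal_power n I k) = enat (2 * k - 1)"
proof (intro allI impI)
  fix k assume k: "n div 2 \<le> k"
  define m where "m = n div 2"
  have m: "1 \<le> m" "n = 2 * m + 1" "m \<le> k"
    using assms(1,2) k by (auto simp: m_def)
  define R where "R = (poly_ring n :: 'k mpoly ring)"
  define J where "J = ideal_power n I k"
  define V where "V = insert n ((*) 2 ` {1..m})"
  define D where "D = {d. \<exists>f\<in>graded_part n d. \<exists>P\<in>Ass R J. colon R J f = P}"
  note vert = cycle_edges_vertices[OF assms(1)]
  have I: "ideal I (poly_ring n)"
    unfolding assms(3) by (rule edge_ideal_is_ideal[OF vert])
  then have J: "ideal J (poly_ring n)"
    unfolding J_def by (rule ideal_power_is_ideal)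
  have "2 * k - 1 \<in> D"
  proof -
    obtain f where f: "f \<in> graded_part n (2 * k - 1)" "colon R J f = weight_ideal n V 1"
      using odd_cycle_power_colon[OF m] unfolding V_def R_def J_def assms(3) by blast
    have "primeideal (colon R J f) R"
      unfolding f(2) unfolding R_def by (rule weight_ideal_prime) (simp add: V_def)
    moreover have "f \<in> carrier R"
      using f(1) by (simp add: graded_part_def R_def)
    ultimately have "colon R J f \<in> Ass R J"
      using cring.prime_colon_in_Ass[OF cring_poly_ring J] unfolding R_def by blast
    with f(1) show ?thesis
      unfolding D_def by blast
  qed
  moreover have "2 * k - 1 \<le> d" if d: "d \<in> D" for d
  proof -
    obtain f where f: "f \<in> graded_part n d" "colon R J f \<in> Ass R J"
      using d unfolding D_def by blast
    then have prime: "primeideal (colon (poly_ring n) J f) (poly_ring n)"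
      by (simp add: Ass_def R_def)
    have "i \<in> {1..n} \<and> j \<in> {1..n}" if "{i, j} \<in> cycle_edges n" for i j
      using that vert by blast
    then have "I \<subseteq> weight_ideal n {1..n} 2"
      unfolding assms(3) by (intro edge_ideal_weight[OF _ vert]) (simp_all add: of_bool_def)
    then have "J \<subseteq> weight_ideal n {1..n} (2 * k)"
      unfolding J_def by (rule ideal_power_weight)
    moreover have "(var 1 * var 2) ^ k \<in> J"
    proof -
      have "{1, 1 + 1} \<in> cycle_edges n"
        using m unfolding cycle_edges_def by force
      from edge_in_edge_ideal[OF vert this] have "var 1 * var 2 \<in> I"
        by (simp add: assms(3) numeral_2_eq_2)
      from ideal_power_mult_power[OF one_in_ideal_power_0 this, of k] show ?thesis
        by (simp add: J_def)
    qed
    ultimately have "2 * k \<le> d + 1"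
      using m by (intro degree_bound_of_prime_colon[OF J _ _ _ _ f(1) prime, of _ 1 2]) auto
    then show ?thesis by simp
  qed
  ultimately have "Inf (enat ` D) = enat (2 * k - 1)"
    by (intro antisym Inf_lower Inf_greatest) auto
  then show "v_number n (ideal_power n I k) = enat (2 * k - 1)"
    unfolding v_number_def D_def R_def J_def .
qed

end
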